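(* Let $b,c$ be rational numbers with $c\neq 2$ and $b\,(c-2)^2=-2$. Then the cubic polynomials $P(x)$ and $Q(d)$ (defined in the context) are reducible over $\mathbb{Q}$. Moreover, each of $P$ and $Q$ has three rational roots (counted with multiplicity), these roots can be labelled $x_1,x_2,x_3$ (roots of $P$) and $d_1,d_2,d_3$ (roots of $Q$) so that the auxiliary equations hold, but these six numbers are not all positive, so they do not provide a solution of the perfect cuboid problem (Problem 1.2).
   Context: Let $b,c$ be rational numbers. Put $\Delta=b^2c^4-6b^2c^3+13b^2c^2-12b^2c+4b^2+c^2$ and $N=(bc-1-b)(bc-c-2b)$, and assume $\Delta\,N\neq 0$, so that all the following rational numbers are defined (with $D=b^2c^2+2b^2-3b^2c+c-bc^2+2b$): $E_{11}=-\frac{b(c^2+2-4c)}{D}$, $E_{01}=-\frac{b(c^2+2-2c)}{D}$, $E_{10}=-\frac{b^2c^2+2b^2-3b^2c-c}{D}$; $E_{20}=\frac{b}{2}(bc^2-2c-2b)(2bc^2-c^2-6bc+2+4b)(bc-1-b)^{-2}(bc-c-2b)^{-2}$; $E_{02}=\frac12(28b^2c^2-16b^2c-2c^2-4b^2-b^2c^4+4b^3c^4-12b^3c^3+4bc^3+24b^3c-8bc-2b^4c^4+12b^4c^3-26b^4c^2-8b^2c^3+24b^4c-16b^3-8b^4)(bc-1-b)^{-2}(bc-c-2b)^{-2}$; $E_{21}=\frac{b}{2}(5c^6b-2c^6b^2+52c^5b^2-16c^5b-2c^7b^2+2b^4c^8+142b^4c^6-26b^4c^7-426b^4c^5-61b^3c^6+100b^3c^5+14c^7b^3-c^8b^3-20bc^2-8b^2c^2-16b^2c-128b^2c^4-200b^3c^3+244b^3c^2+32bc^3-112b^3c+768b^4c^4-852b^4c^3+568b^4c^2+104b^2c^3-208b^4c+8c^4-4c^3+16b^3+32b^4-2c^5)\,\Delta^{-1}(bc-1-b)^{-2}(bc-c-2b)^{-2}$;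 $E_{12}=(16b^6+32b^5-6c^5b^2+2c^5b-62b^5c^6+62b^6c^6-180b^6c^5+18b^5c^7-12b^6c^7-2b^5c^8+b^6c^8+248b^5c^2+248b^6c^2-96b^6c+321b^6c^4-180b^5c^3-144b^5c-360b^6c^3+b^4c^8+8b^4c^6-6b^4c^7+18b^4c^5+7b^3c^6+90b^5c^5-14b^3c^5-c^7b^3+17b^2c^4+28b^3c^3-28b^3c^2-4bc^3+8b^3c-57b^4c^4+36b^4c^3+32b^4c^2-12b^2c^3-48b^4c-c^4+16b^4)\,\Delta^{-1}(bc-1-b)^{-2}(bc-c-2b)^{-2}$; $E_{03}=\frac{b}{2}(b^2c^4-5b^2c^3+10b^2c^2-10b^2c+4b^2+2bc+2c^2-bc^3)(2b^2c^4-12b^2c^3+26b^2c^2-24b^2c+8b^2-c^4b+3bc^3-6bc+4b+c^3-2c^2+2c)\,\Delta^{-1}(bc-1-b)^{-2}(bc-c-2b)^{-2}$; $E_{30}=c\,b^2(1-c)(c-2)(bc^2-4bc+2+4b)(2bc^2-c^2-4bc+2b)\,\Delta^{-1}(bc-1-b)^{-2}(bc-c-2b)^{-2}$. Define $P(x)=x^3-E_{10}x^2+E_{20}x-E_{30}$ and $Q(d)=d^3-E_{01}d^2+E_{02}d-E_{03}$. For numbers $x_1,x_2,x_3,d_1,d_2,d_3$ the auxiliary equations are: $x_1x_2d_3+x_2x_3d_1+x_3x_1d_2=E_{21}$, $x_1d_2+d_1x_2+x_2d_3+d_2x_3+x_3d_1+d_3x_1=E_{11}$, $x_1d_2d_3+x_2d_3d_1+x_3d_1d_2=E_{12}$.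 Problem 1.2 (equivalent to finding a perfect cuboid) asks for rational $b,c$ such that $P$ and $Q$ have positive rational roots $x_1,x_2,x_3$ and $d_1,d_2,d_3$ satisfying the auxiliary equations. *)

theory Defs
  imports "HOL-Computational_Algebra.Computational_Algebra"
begin

definition Delta :: "rat \<Rightarrow> rat \<Rightarrow> rat" where
  "Delta b c =
     b^2 * c^4 - 6 * b^2 * c^3 + 13 * b^2 * c^2 - 12 * b^2 * c + 4 * b^2 + c^2"

definition Nfac :: "rat \<Rightarrow> rat \<Rightarrow> rat" where
  "Nfac b c =
     (b * c - 1 - b) * (b * c - c - 2 * b)"

(* The expanded form of Nfac. *)
definition Dden :: "rat \<Rightarrow> rat \<Rightarrow> rat" where
  "Dden b c =
     b^2 * c^2 + 2 * b^2 - 3 * b^2 * c + c - b * c^2 + 2 * b"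

definition E11 :: "rat \<Rightarrow> rat \<Rightarrow> rat" where
  "E11 b c =
     - (b * (c^2 + 2 - 4 * c)) / Dden b c"

definition E01 :: "rat \<Rightarrow> rat \<Rightarrow> rat" where
  "E01 b c =
     - (b * (c^2 + 2 - 2 * c)) / Dden b c"

definition E10 :: "rat \<Rightarrow> rat \<Rightarrow> rat" where
  "E10 b c =
     - (b^2 * c^2 + 2 * b^2 - 3 * b^2 * c - c) / Dden b c"

definition E20 :: "rat \<Rightarrow> rat \<Rightarrow> rat" where
  "E20 b c =
     b / 2 * ((b * c^2 - 2 * c - 2 * b) * (2 * b * c^2 - c^2 - 6 * b * c + 2 + 4 * b))
     / Nfac b c ^ 2"

definition E02 :: "rat \<Rightarrow> rat \<Rightarrow> rat" where
  "E02 b c =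
     1 / 2 * (28 * b^2 * c^2 - 16 * b^2 * c - 2 * c^2 - 4 * b^2 - b^2 * c^4 + 4 * b^3 * c^4 - 12
      * b^3 * c^3 + 4 * b * c^3 + 24 * b^3 * c - 8 * b * c - 2 * b^4 * c^4 + 12 * b^4 *
      c^3 - 26 * b^4 * c^2 - 8 * b^2 * c^3 + 24 * b^4 * c - 16 * b^3 - 8 * b^4)
     / Nfac b c ^ 2"

definition E21 :: "rat \<Rightarrow> rat \<Rightarrow> rat" where
  "E21 b c =
     b / 2 * (5 * c^6 * b - 2 * c^6 * b^2 + 52 * c^5 * b^2 - 16 * c^5 * b - 2 * c^7 * b^2 + 2 *
      b^4 * c^8 + 142 * b^4 * c^6 - 26 * b^4 * c^7 - 426 * b^4 * c^5 - 61 * b^3 * c^6 +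
      100 * b^3 * c^5 + 14 * c^7 * b^3 - c^8 * b^3 - 20 * b * c^2 - 8 * b^2 * c^2 - 16 *
      b^2 * c - 128 * b^2 * c^4 - 200 * b^3 * c^3 + 244 * b^3 * c^2 + 32 * b * c^3 - 112 *
      b^3 * c + 768 * b^4 * c^4 - 852 * b^4 * c^3 + 568 * b^4 * c^2 + 104 * b^2 * c^3 -
      208 * b^4 * c + 8 * c^4 - 4 * c^3 + 16 * b^3 + 32 * b^4 - 2 * c^5)
     / (Delta b c * Nfac b c ^ 2)"

definition E12 :: "rat \<Rightarrow> rat \<Rightarrow> rat" where
  "E12 b c =
     (16 * b^6 + 32 * b^5 - 6 * c^5 * b^2 + 2 * c^5 * b - 62 * b^5 * c^6 + 62 * b^6 * c^6
      - 180 * b^6 * c^5 + 18 * b^5 * c^7 - 12 * b^6 * c^7 - 2 * b^5 * c^8 + b^6 * c^8 +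
      248 * b^5 * c^2 + 248 * b^6 * c^2 - 96 * b^6 * c + 321 * b^6 * c^4 - 180 * b^5 * c^3
      - 144 * b^5 * c - 360 * b^6 * c^3 + b^4 * c^8 + 8 * b^4 * c^6 - 6 * b^4 * c^7 + 18 *
      b^4 * c^5 + 7 * b^3 * c^6 + 90 * b^5 * c^5 - 14 * b^3 * c^5 - c^7 * b^3 + 17 * b^2 *
      c^4 + 28 * b^3 * c^3 - 28 * b^3 * c^2 - 4 * b * c^3 + 8 * b^3 * c - 57 * b^4 * c^4 +
      36 * b^4 * c^3 + 32 * b^4 * c^2 - 12 * b^2 * c^3 - 48 * b^4 * c - c^4 + 16 * b^4)
     / (Delta b c * Nfac b c ^ 2)"

definition E03 :: "rat \<Rightarrow> rat \<Rightarrow> rat" where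
  "E03 b c =
     b / 2 * ((b^2 * c^4 - 5 * b^2 * c^3 + 10 * b^2 * c^2 - 10 * b^2 * c + 4 * b^2 + 2 * b * c + 2
      * c^2 - b * c^3) * (2 * b^2 * c^4 - 12 * b^2 * c^3 + 26 * b^2 * c^2 - 24 * b^2 * c +
      8 * b^2 - c^4 * b + 3 * b * c^3 - 6 * b * c + 4 * b + c^3 - 2 * c^2 + 2 * c))
     / (Delta b c * Nfac b c ^ 2)"

definition E30 :: "rat \<Rightarrow> rat \<Rightarrow> rat" where
  "E30 b c =
     (c * b^2 * (1 - c) * (c - 2) * (b * c^2 - 4 * b * c + 2 + 4 * b) * (2 * b * c^2 - c^2
      - 4 * b * c + 2 * b))
     / (Delta b c * Nfac b c ^ 2)"

definition P :: "rat \<Rightarrow> rat \<Rightarrow> rat poly" where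
  "P b c = [:- E30 b c, E20 b c, - E10 b c, 1:]"

definition Q :: "rat \<Rightarrow> rat \<Rightarrow> rat poly" where
  "Q b c = [:- E03 b c, E02 b c, - E01 b c, 1:]"

definition auxiliary_equations ::
  "rat \<Rightarrow> rat \<Rightarrow> rat \<Rightarrow> rat \<Rightarrow> rat \<Rightarrow> rat \<Rightarrow> rat \<Rightarrow> rat \<Rightarrow> bool" where
  "auxiliary_equations b c x1 x2 x3 d1 d2 d3 \<longleftrightarrow>
     x1 * x2 * d3 + x2 * x3 * d1 + x3 * x1 * d2 = E21 b c \<and>
     x1 * d2 + d1 * x2 + x2 * d3 + d2 * x3 + x3 * d1 + d3 * x1 = E11 b c \<and>
     x1 * d2 * d3 + x2 * d3 * d1 + x3 * d1 * d2 = E12 b c"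

(* proots counts roots with multiplicity and, over rat, contains rational roots only. *)
definition cuboid_problem_solution :: "rat \<Rightarrow> rat \<Rightarrow> bool" where
  "cuboid_problem_solution b c \<longleftrightarrow>
     Delta b c * Nfac b c \<noteq> 0 \<and>
     (\<exists>x1 x2 x3 d1 d2 d3.
        proots (P b c) = {#x1, x2, x3#} \<and> proots (Q b c) = {#d1, d2, d3#} \<and>
        auxiliary_equations b c x1 x2 x3 d1 d2 d3 \<and>
        x1 > 0 \<and> x2 > 0 \<and> x3 > 0 \<and> d1 > 0 \<and> d2 > 0 \<and> d3 > 0)"

end

theory Submission
  imports Defs
begin

text \<open>
  Put \<open>t = c - 2\<close>, \<open>x = t (t + 2)\<close>, \<open>y = 2 (t + 1)\<close> and \<open>w = t\<^sup>2 + 2 t + 2\<close>, which is nonzero.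
  On the curve \<open>b t\<^sup>2 = -2\<close> the denominators collapse to \<open>N = D = w\<^sup>2 / t\<^sup>3\<close> and
  \<open>\<Delta> = w\<^sup>2 / t\<^sup>2\<close>, and comparing the coefficients with the elementary symmetric functions shows that
  the roots of \<open>P\<close> are \<open>0, x/w, -y/w\<close> and those of \<open>Q\<close> are \<open>-1, y/w, x/w\<close>.  The root \<open>0\<close> of \<open>P\<close>, caused
  by the factor \<open>b c\<^sup>2 - 4 b c + 2 + 4 b = b t\<^sup>2 + 2\<close> of \<^const>\<open>E30\<close>, excludes a positive solution.
\<close>

lemma cubic_poly_eq_prod_linear:
  fixes x y z :: "'a::comm_ring_1"
  shows "[:- (x * y * z), x * y + y * z + z * x, - (x + y + z), 1:]
    = [:-x, 1:] * ([:-y, 1:] * [:-z, 1:])"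
  by (simp add: algebra_simps)

lemma proots_cubic:
  fixes x y z :: "'a::idom"
  shows "proots [:- (x * y * z), x * y + y * z + z * x, - (x + y + z), 1:] = {#x, y, z#}"
  unfolding cubic_poly_eq_prod_linear by (subst proots_mult, simp, simp)+ simp

lemma not_irreducible_cubic:
  fixes x y z :: "'a::field"
  shows "\<not> irreducible [:- (x * y * z), x * y + y * z + z * x, - (x + y + z), 1:]"
proof
  assume "irreducible [:- (x * y * z), x * y + y * z + z * x, - (x + y + z), 1:]"
  then have "[:-x, 1:] dvd 1 \<or> [:-y, 1:] * [:-z, 1:] dvd 1"
    unfolding cubic_poly_eq_prod_linear by (rule irreducibleD[OF _ refl])
  then show False
    by (auto simp: is_unit_iff_degree degree_mult_eq)
qed

context
  fixes b c t w x y :: rat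
  assumes c2: "c \<noteq> 2"
    and bc: "b * (c - 2)\<^sup>2 = -2"
  defines "t \<equiv> c - 2"
    and "w \<equiv> (c - 2)\<^sup>2 + 2 * (c - 2) + 2"
    and "x \<equiv> (c - 2) * ((c - 2) + 2)"
    and "y \<equiv> 2 * ((c - 2) + 1)"
begin

lemma t_nonzero: "t \<noteq> 0"
  using c2 by (simp add: t_def)

lemma bt: "b * t\<^sup>2 = -2"
  using bc by (simp add: t_def)

lemma c_eq: "c = t + 2"
  by (simp add: t_def)

lemma w_eq: "w = t\<^sup>2 + 2 * t + 2"
  and x_eq: "x = t * (t + 2)"
  and y_eq: "y = 2 * (t + 1)"
  by (simp_all add: w_def x_def y_def t_def)

lemma w_nonzero: "w \<noteq> 0"
proof -
  have "w = (t + 1)\<^sup>2 + 1"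
    by (simp add: w_eq power2_eq_square algebra_simps)
  also have "\<dots> > 0"
    by (simp add: add_nonneg_pos)
  finally show ?thesis
    by simp
qed

text \<open>Scaled by \<open>t^2\<close> and \<open>t\<close> respectively, the factors
  \<open>b * c - 1 - b\<close> and \<open>b * c - c - 2 * b\<close> both become
  \<open>- w\<close>.\<close>

lemma Nfac_curve: "Nfac b c * t^3 = w^2"
  using bt unfolding Nfac_def w_eq c_eq by algebra

lemma Dden_curve: "Dden b c * t^3 = w^2"
  using bt unfolding Dden_def w_eq c_eq by algebra

text \<open>\<open>Delta b c\<close> is \<open>(b * (c - 1) * (c - 2))^2 + c^2\<close>; times
  \<open>t^2\<close> this is \<open>y^2 + x^2\<close>, and \<open>x\<close>, \<open>y\<close>,
  \<open>w\<close> form the Pythagorean triple with parameter \<open>t + 1\<close>.\<close>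

lemma Delta_curve: "Delta b c * t^2 = w^2"
  using bt unfolding Delta_def w_eq c_eq by algebra

text \<open>Scaling by a power of \<open>t\<close> reduces a coefficient formula to a polynomial
  identity modulo \<open>bt\<close>, which \<open>algebra\<close> can settle.\<close>

lemma divide_Dden:
  assumes "m * t^3 = s"
  shows "m / Dden b c = s / w^2"
  using assms Dden_curve t_nonzero by (metis mult_divide_mult_cancel_right power_not_zero)

lemma divide_Nfac_sq:
  assumes "m * t^6 = s * w^2"
  shows "m / Nfac b c ^ 2 = s / w^2"
proof -
  have "m / Nfac b c ^ 2 = (m * t^6) / (Nfac b c * t^3)^2"
    using t_nonzero by (simp add: power_mult_distrib flip: power_mult)
  also have "\<dots> = (s * w^2) / (w^2 * w^2)"
    unfolding Nfac_curve assms by (simp add: power2_eq_square)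
  also have "\<dots> = s / w^2"
    using w_nonzero by (simp only: mult_divide_mult_cancel_right power_not_zero not_False_eq_True)
  finally show ?thesis .
qed

text \<open>The scaled denominator is \<open>w^6\<close>, so the \<open>w^4\<close> in the
  assumption cancels down to the common denominator \<open>w^2\<close>.\<close>

lemma divide_Delta_Nfac_sq:
  assumes "m * t^8 = s * w^4"
  shows "m / (Delta b c * Nfac b c ^ 2) = s / w^2"
proof -
  have "t^8 = t^2 * (t^3)^2"
    by (simp flip: power_mult power_add)
  then have "m / (Delta b c * Nfac b c ^ 2) = (m * t^8) / ((Delta b c * t^2) * (Nfac b c * t^3)^2)"
    using t_nonzero by (simp add: power_mult_distrib mult_ac)
  also have "\<dots> = (s * w^4) / (w^2 * w^4)"
    unfolding Nfac_curve Delta_curve assms by (simp flip: power_mult)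
  also have "\<dots> = s / w^2"
    using w_nonzero by (simp add: field_simps)
  finally show ?thesis .
qed

lemma E10_curve: "E10 b c = (x - y) * w / w^2"
  unfolding E10_def
  by (rule divide_Dden) (use bt in \<open>unfold w_eq x_eq y_eq c_eq, algebra\<close>)

lemma E01_curve: "E01 b c = (x + y - w) * w / w^2"
  unfolding E01_def
  by (rule divide_Dden) (use bt in \<open>unfold w_eq x_eq y_eq c_eq, algebra\<close>)

lemma E11_curve: "E11 b c = (x^2 - y^2 - (x - y) * w) / w^2"
  unfolding E11_def
  by (rule divide_Dden) (use bt in \<open>unfold w_eq x_eq y_eq c_eq, algebra\<close>)

lemma E20_curve: "E20 b c = - (x * y) / w^2"
  unfolding E20_def
  by (rule divide_Nfac_sq) (use bt in \<open>unfold w_eq x_eq y_eq c_eq, algebra\<close>)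

lemma E02_curve: "E02 b c = (x * y - (x + y) * w) / w^2"
  unfolding E02_def
  by (rule divide_Nfac_sq) (use bt in \<open>unfold w_eq x_eq y_eq c_eq, algebra\<close>)

lemma E03_curve: "E03 b c = - (x * y) / w^2"
  unfolding E03_def
  by (rule divide_Delta_Nfac_sq) (use bt in \<open>unfold w_eq x_eq y_eq c_eq, algebra\<close>)

lemma E21_curve: "E21 b c = (x * y) / w^2"
  unfolding E21_def
  by (rule divide_Delta_Nfac_sq) (use bt in \<open>unfold w_eq x_eq y_eq c_eq, algebra\<close>)

lemma E12_curve: "E12 b c = (y^2 - x^2) / w^2"
  unfolding E12_def
  by (rule divide_Delta_Nfac_sq) (use bt in \<open>unfold w_eq x_eq y_eq c_eq, algebra\<close>)

lemma E30_curve: "E30 b c = 0"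
proof -
  have "b * c^2 - 4 * b * c + 2 + 4 * b = 0"
    using bt unfolding c_eq by algebra
  then show ?thesis
    by (simp add: E30_def)
qed

text \<open>The zero terms stay unsimplified so that the coefficients match
  \<open>proots_cubic\<close> and \<open>not_irreducible_cubic\<close> literally.\<close>

lemma P_curve:
  "P b c = [:- (0 * (x / w) * (- y / w)),
    0 * (x / w) + x / w * (- y / w) + - y / w * 0, - (0 + x / w + - y / w), 1:]"
  using w_nonzero
  by (simp add: P_def E10_curve E20_curve E30_curve field_simps power2_eq_square)

lemma Q_curve:
  "Q b c = [:- (- 1 * (y / w) * (x / w)),
    - 1 * (y / w) + y / w * (x / w) + x / w * - 1, - (- 1 + y / w + x / w), 1:]"
  using w_nonzero
  by (simp add: Q_def E01_curve E02_curve E03_curve field_simps power2_eq_square)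

lemma not_irreducible_curve: "\<not> irreducible (P b c)" "\<not> irreducible (Q b c)"
  unfolding P_curve Q_curve by (rule not_irreducible_cubic)+

lemma proots_curve:
  "proots (P b c) = {#0, x / w, - y / w#}" "proots (Q b c) = {#- 1, y / w, x / w#}"
  unfolding P_curve Q_curve by (rule proots_cubic)+

text \<open>The labelling makes each pair (\<open>0\<close>, \<open>-1\<close>),
  (\<open>x / w\<close>, \<open>y / w\<close>), (\<open>- y / w\<close>, \<open>x / w\<close>) a
  point of the unit circle.\<close>

lemma auxiliary_equations_curve:
  "auxiliary_equations b c 0 (x / w) (- y / w) (- 1) (y / w) (x / w)"
  using w_nonzero
  by (simp add: auxiliary_equations_def E21_curve E11_curve E12_curve
      field_simps power2_eq_square)

lemma no_solution_curve: "\<not> cuboid_problem_solution b c"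
proof
  assume "cuboid_problem_solution b c"
  then obtain x1 x2 x3 where "proots (P b c) = {#x1, x2, x3#}" "x1 > 0" "x2 > 0" "x3 > 0"
    by (auto simp: cuboid_problem_solution_def)
  moreover have "0 \<in># proots (P b c)"
    by (simp add: proots_curve)
  ultimately show False
    by auto
qed

end

theorem theorem7p1:
  fixes b c :: rat
  assumes "Delta b c * Nfac b c \<noteq> 0"
    and "c \<noteq> 2"
    and "b * (c - 2)^2 = -2"
  shows "\<not> irreducible (P b c) \<and> \<not> irreducible (Q b c) \<and>
    (\<exists>x1 x2 x3 d1 d2 d3.
       proots (P b c) = {#x1, x2, x3#} \<and> proots (Q b c) = {#d1, d2, d3#} \<and>
       auxiliary_equations b c x1 x2 x3 d1 d2 d3 \<and>
       \<not> (x1 > 0 \<and> x2 > 0 \<and> x3 > 0 \<and> d1 > 0 \<and> d2 > 0 \<and> d3 > 0)) \<and>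
    \<not> cuboid_problem_solution b c"
  using not_irreducible_curve[OF assms(2,3)] proots_curve[OF assms(2,3)]
    auxiliary_equations_curve[OF assms(2,3)] no_solution_curve[OF assms(2,3)]
  \<comment> \<open>The witness \<open>x1 = 0\<close> already violates positivity.\<close>
  by (metis less_irrefl)

end
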